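(* Suppose $\mathcal{C}$ is a distinct covering system all of whose moduli are of the form $2^a 3^b 5^c$ with $a$, $b$, $c$ nonnegative integers (depending on the modulus), and let $m$ be its least modulus. Then $m \leq 9$.
   Context: A covering system is a finite set of congruences $x \equiv r_i \pmod{n_i}$, $i=1,\ldots,k$, such that every integer satisfies at least one of the congruences. A distinct covering system is a covering system in which all moduli $n_i$ are distinct integers greater than $1$. The least modulus $m$ is the smallest of the $n_i$. *)

theory Defs
  imports "HOL-Number_Theory.Cong"
begin

text \<open>The pair \<open>(r, n)\<close> stands for the congruence \<open>x \<equiv> r (mod n)\<close>.  Moduli are positive:
  in the library, a congruence modulo \<open>0\<close> would mean equality.\<close>

definition covering_system :: "(int \<times> nat) set \<Rightarrow> bool" where
  "covering_system C \<longleftrightarrow>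
     finite C \<and> (\<forall>(r, n)\<in>C. n > 0) \<and> (\<forall>x::int. \<exists>(r, n)\<in>C. [x = r] (mod int n))"

definition moduli :: "(int \<times> nat) set \<Rightarrow> nat set" where
  "moduli C = snd ` C"

text \<open>Injectivity of \<open>snd\<close> says that no modulus is used by two congruences of the system.\<close>

definition distinct_covering_system :: "(int \<times> nat) set \<Rightarrow> bool" where
  "distinct_covering_system C \<longleftrightarrow>
     covering_system C \<and> inj_on snd C \<and> (\<forall>n\<in>moduli C. n > 1)"

text \<open>A covering system is finite and nonempty, so the minimum below is a genuine one.\<close>

definition least_modulus :: "(int \<times> nat) set \<Rightarrow> nat" where
  "least_modulus C = Min (moduli C)"

end

theory Submission
  imports Defs "HOL-Probability.Product_PMF"
begin

text \<open>The numbers \<open>2 ^ a * 3 ^ b * 5 ^ c\<close> have reciprocal sum \<open>2 * 3/2 * 5/4 = 15/4\<close>, and those at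
  least \<open>10\<close> have reciprocal sum \<open>383/360\<close>, barely more than \<open>1\<close>.  So a cover with least modulus at
  least \<open>10\<close> can afford very little overlap, and the proof shows that it is forced to overlap more.

  By the Chinese remainder theorem a random integer becomes a triple of independent coordinates
  \<open>(i, j, k)\<close>, uniform modulo powers of \<open>2\<close>, \<open>3\<close> and \<open>5\<close>.  Let \<open>X2, X3, X5, X23, X25, X35, X235\<close> be
  the unions of the classes whose moduli have exactly the indicated prime divisors; their
  measures are at most \<open>1/8, 1/18, 1/20, 1/3, 1/4, 1/8, 1/8\<close>.  Independence of \<open>X2, X3, X5\<close> from each
  other, of \<open>X5\<close> from \<open>X23\<close>, of \<open>X3\<close> from \<open>X25\<close> and of \<open>X2\<close> from \<open>X35\<close> turns the covering property into
  \<open>7/8 * 17/18 * 19/20 \<le> 1/3 * 19/20 + 1/4 * 17/18 + 1/8 * 7/8 + 1/8\<close> in the extreme case.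
  This is true, but the right-hand side wins by \<open>1/480\<close> only.  Hence every further overlap
  together, and every missing modulus, must be worth at most \<open>1/480\<close> (lemma \<open>gains_le_slack\<close>).  In particular
  \<open>10\<close>, \<open>15\<close> and \<open>45\<close> are moduli of the cover.

  The classes in \<open>X23\<close>, \<open>X25\<close>, \<open>X35\<close> can avoid each other only by being separated in a common
  coordinate.  Let \<open>U e10\<close> be the parity class of the congruence modulo \<open>10\<close> and \<open>V e15\<close> the class
  modulo \<open>3\<close> of the congruence modulo \<open>15\<close>.  Then \<open>X23\<close> wants to stay in the rectangle \<open>R\<close> where both
  coordinates avoid these classes.  This rectangle has measure \<open>1/2 * 2/3 = 1/3\<close>, exactly the total
  mass of \<open>X23\<close>: so \<open>X23\<close> either fills \<open>R\<close>, or pays for what it places elsewhere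
  (lemma \<open>prob_T1_uncovered\<close>).  A full \<open>R\<close> in turn pushes the other classes out of it: \<open>X35\<close> into
  \<open>V e15\<close> (lemma \<open>prob_T1_overlap_35\<close>), and \<open>X2\<close>, \<open>X25\<close> into \<open>U e10\<close> (lemma \<open>prob_T1_overlap_25\<close>).
  The first effect forces the class modulo \<open>45\<close> to agree modulo \<open>3\<close>, and hence to disagree
  modulo \<open>5\<close>, with the class modulo \<open>15\<close> (lemmas \<open>V45_subset_V15\<close> and \<open>W45_disjoint_W15\<close>).

  Now \<open>X25\<close> wants to avoid two of the five residues modulo \<open>5\<close>, so it is confined to a part of measure
  \<open>1/2 * 3/5 = 3/10\<close>.  But \<open>X25\<close> has measure \<open>1/4\<close>, and \<open>X2\<close>, which cannot see the residue modulo \<open>5\<close>,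
  takes another \<open>3/5 * 1/8 = 3/40\<close> of the same part: an excess of \<open>1/40\<close>.  Displacing it costs at least
  \<open>9/100\<close> of its measure, which is \<open>9/4000 > 1/480\<close> (lemma \<open>no_smooth_cover\<close>).\<close>

section \<open>Products of probability mass functions\<close>

abbreviation "prob \<equiv> measure_pmf.prob"

lemma prob_times:
  fixes M :: "'a::countable pmf" and N :: "'b::countable pmf"
  shows "prob (pair_pmf M N) (A \<times> B) = prob M A * prob N B"
  by (rule measure_pmf_prob_product) (rule countableI_type)+

text \<open>The next three lemmas express independence of one coordinate of a triple from the other two.
  They are what separates \<open>X5\<close> from \<open>X23\<close>, \<open>X3\<close> from \<open>X25\<close>, and \<open>X2\<close> from \<open>X35\<close>.\<close>

lemma prob_cylinder_12:
  fixes p q r :: "'a::countable pmf"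
  shows "prob (pair_pmf p (pair_pmf q r)) {(i, j, k). (i, j) \<in> A \<and> k \<in> B}
    = prob (pair_pmf p q) A * prob r B"
proof -
  have "pair_pmf (pair_pmf p q) r
      = map_pmf (\<lambda>(i, j, k). ((i, j), k)) (pair_pmf p (pair_pmf q r))"
    by (simp add: pair_pmf_def map_pmf_def bind_assoc_pmf bind_return_pmf)
  moreover have "(\<lambda>(i, j, k). ((i, j), k)) -` (A \<times> B) = {(i, j, k). (i, j) \<in> A \<and> k \<in> B}"
    by auto
  ultimately show ?thesis
    using prob_times[of "pair_pmf p q" r A B] by simp
qed

lemma prob_cylinder_13:
  fixes p q r :: "'a::countable pmf"
  shows "prob (pair_pmf p (pair_pmf q r)) {(i, j, k). (i, k) \<in> A \<and> j \<in> B}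
    = prob (pair_pmf p r) A * prob q B"
proof -
  have "pair_pmf q r = map_pmf (\<lambda>(k, j). (j, k)) (pair_pmf r q)"
    by (rule pair_commute_pmf)
  then have "pair_pmf p (pair_pmf q r)
      = map_pmf (\<lambda>(i, k, j). (i, j, k)) (pair_pmf p (pair_pmf r q))"
    by (simp add: pair_pmf_def map_pmf_def bind_assoc_pmf bind_return_pmf)
  moreover have "(\<lambda>(i, k, j). (i, j, k)) -` {(i, j, k). (i, k) \<in> A \<and> j \<in> B}
      = {(i, k, j). (i, k) \<in> A \<and> j \<in> B}"
    by auto
  ultimately show ?thesis
    using prob_cylinder_12[of p r q A B] by simp
qed

lemma prob_cylinder_23:
  fixes p q r :: "'a::countable pmf"
  shows "prob (pair_pmf p (pair_pmf q r)) {(i, j, k). i \<in> B \<and> (j, k) \<in> A}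
    = prob p B * prob (pair_pmf q r) A"
proof -
  have "{(i, j, k). i \<in> B \<and> (j, k) \<in> A} = B \<times> A"
    by auto
  then show ?thesis
    by (simp add: prob_times)
qed

lemma prob_mono: "A \<subseteq> B \<Longrightarrow> prob M A \<le> prob M B"
  by (simp add: measure_pmf.finite_measure_mono)

lemma prob_Un_le: "prob M (A \<union> B) \<le> prob M A + prob M B"
  by (rule measure_Un_le) auto

lemma prob_Int_Diff: "prob M A = prob M (A \<inter> B) + prob M (A - B)"
  using measure_pmf.finite_measure_Union[of "A \<inter> B" M "A - B"]
  by (simp add: Int_Diff_Un Int_Diff_disjoint)

lemma prob_Compl: "prob M (- A) = 1 - prob M A"
  using measure_pmf.prob_compl[of A M] by (simp add: Compl_eq_Diff_UNIV)

lemma prob_UN_le: "finite F \<Longrightarrow> prob M (\<Union>e\<in>F. A e) \<le> (\<Sum>e\<in>F. prob M (A e))"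
  by (rule measure_pmf.finite_measure_subadditive_finite) auto

lemma prob_Diff: "prob M (A - B) = prob M A - prob M (B \<inter> A)"
  by (metis Int_commute add_diff_cancel_left' prob_Int_Diff)

section \<open>Sums of reciprocals of numbers without prime factors above 5\<close>

lemma sum_inverse_powers_le:
  fixes x :: real
  assumes "x > 1" "finite A" "A \<subseteq> {m..}"
  shows "(\<Sum>a\<in>A. 1 / x ^ a) \<le> 1 / (x ^ m * (1 - 1 / x))"
proof -
  have s: "(\<lambda>a. (1 / x) ^ a) sums (1 / (1 - 1 / x))"
    using assms(1) by (intro geometric_sums) auto
  have "(\<lambda>a. 1 / x ^ m * (1 / x) ^ a) sums (1 / x ^ m * (1 / (1 - 1 / x)))"
    by (intro sums_mult s)
  then have t: "(\<lambda>a. 1 / x ^ (a + m)) sums (1 / (x ^ m * (1 - 1 / x)))"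
    by (simp add: power_add field_simps)
  have "(\<Sum>a\<in>A. 1 / x ^ a) = (\<Sum>a\<in>(\<lambda>a. a - m) ` A. 1 / x ^ (a + m))"
  proof (subst sum.reindex)
    show "inj_on (\<lambda>a. a - m) A"
      using assms(3) by (intro inj_on_diff_nat) auto
  qed (use assms(3) in \<open>auto simp: subset_iff intro!: sum.cong\<close>)
  also have "\<dots> \<le> (\<Sum>a. 1 / x ^ (a + m))"
    using t assms by (intro sum_le_suminf) (auto simp: sums_iff)
  also have "\<dots> = 1 / (x ^ m * (1 - 1 / x))"
    using t by (simp add: sums_iff)
  finally show ?thesis .
qed

lemma sum_product_le:
  fixes g :: "'a \<Rightarrow> real" and h :: "'b \<Rightarrow> real"
  assumes "finite F" "F \<subseteq> A \<times> B"
    and g: "\<And>X. finite X \<Longrightarrow> X \<subseteq> A \<Longrightarrow> sum g X \<le> s" "\<And>a. 0 \<le> g a"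
    and h: "\<And>Y. finite Y \<Longrightarrow> Y \<subseteq> B \<Longrightarrow> sum h Y \<le> t" "\<And>b. 0 \<le> h b"
  shows "(\<Sum>(a, b)\<in>F. g a * h b) \<le> s * t"
proof -
  have "(\<Sum>(a, b)\<in>F. g a * h b) \<le> (\<Sum>(a, b)\<in>fst ` F \<times> snd ` F. g a * h b)"
    proof (rule sum_mono2)
    show "F \<subseteq> fst ` F \<times> snd ` F"
      by (rule subset_fst_snd)
  qed (use assms in auto)
  also have "\<dots> = sum g (fst ` F) * sum h (snd ` F)"
    by (simp add: sum_product sum.cartesian_product)
  also have "\<dots> \<le> s * t"
  proof (rule mult_mono)
    show "sum g (fst ` F) \<le> s" "sum h (snd ` F) \<le> t"
      using assms(1,2) by (auto intro!: g(1) h(1))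
    show "0 \<le> s"
      using g(1)[of "{}"] by simp
  qed (auto intro: sum_nonneg h(2))
  finally show ?thesis .
qed

text \<open>A triple \<open>(a, b, c)\<close> of exponents stands for the modulus \<open>2 ^ a * 3 ^ b * 5 ^ c\<close>, and \<open>weight\<close> is the
  density of its residue classes.\<close>

definition weight :: "nat \<times> nat \<times> nat \<Rightarrow> real" where
  "weight = (\<lambda>(a, b, c). 1 / 2 ^ a * (1 / 3 ^ b * (1 / 5 ^ c)))"

text \<open>A finite set of exponent triples lies in a finite box, over which the sum factors as in Euler's
  product.\<close>

lemma sum_weight_le:
  assumes "finite F" "F \<subseteq> A \<times> B \<times> C"
    and "\<And>X. finite X \<Longrightarrow> X \<subseteq> A \<Longrightarrow> (\<Sum>a\<in>X. 1 / 2 ^ a :: real) \<le> s"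
    and "\<And>X. finite X \<Longrightarrow> X \<subseteq> B \<Longrightarrow> (\<Sum>a\<in>X. 1 / 3 ^ a :: real) \<le> t"
    and "\<And>X. finite X \<Longrightarrow> X \<subseteq> C \<Longrightarrow> (\<Sum>a\<in>X. 1 / 5 ^ a :: real) \<le> u"
  shows "sum weight F \<le> s * (t * u)"
proof -
  have "(\<Sum>(b, c)\<in>X. 1 / 3 ^ b * (1 / 5 ^ c)) \<le> t * u" if "finite X" "X \<subseteq> B \<times> C" for X
    by (rule sum_product_le[OF that]) (use assms in auto)
  then have "(\<Sum>(a, b, c)\<in>F. 1 / 2 ^ a * (case (b, c) of (b, c) \<Rightarrow> 1 / 3 ^ b * (1 / 5 ^ c))) \<le> s * (t * u)"
    using sum_product_le[where F = F and A = A and B = "B \<times> C" and g = "\<lambda>a. 1 / 2 ^ a"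
        and h = "\<lambda>(b, c). 1 / 3 ^ b * (1 / 5 ^ c)" and s = s and t = "t * u"] assms
    by (auto simp: case_prod_unfold)
  then show ?thesis
    by (simp add: weight_def case_prod_unfold)
qed

lemma sum_powers_2: "finite X \<Longrightarrow> X \<subseteq> {m..} \<Longrightarrow> (\<Sum>a\<in>X. 1 / 2 ^ a :: real) \<le> 2 / 2 ^ m"
  using sum_inverse_powers_le[of 2 X m] by simp

lemma sum_powers_3: "finite X \<Longrightarrow> X \<subseteq> {m..} \<Longrightarrow> (\<Sum>a\<in>X. 1 / 3 ^ a :: real) \<le> 3 / (2 * 3 ^ m)"
  using sum_inverse_powers_le[of 3 X m] by (simp add: field_simps)

lemma sum_powers_5: "finite X \<Longrightarrow> X \<subseteq> {m..} \<Longrightarrow> (\<Sum>a\<in>X. 1 / 5 ^ a :: real) \<le> 5 / (4 * 5 ^ m)"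
  using sum_inverse_powers_le[of 5 X m] by (simp add: field_simps)

lemma sum_powers_0: "finite X \<Longrightarrow> X \<subseteq> {0} \<Longrightarrow> (\<Sum>a\<in>X. 1 / x ^ a :: real) \<le> 1"
  by (auto simp: subset_singleton_iff)

section \<open>Residue classes under the uniform distribution\<close>

definition residue_class :: "int \<Rightarrow> int \<Rightarrow> int set" where
  "residue_class d s = {x. [x = s] (mod d)}"

text \<open>This is why overlaps are easy to locate: within one coordinate, all classes have moduli that are
  powers of the same prime, so they form a tree.\<close>

lemma residue_classes_nested_or_disjoint:
  assumes "d dvd e"
  shows "residue_class e s \<subseteq> residue_class d t \<or> residue_class e s \<inter> residue_class d t = {}"
proof (cases "[s = t] (mod d)")
  case True
  then show ?thesis
    using assms by (auto simp: residue_class_def intro: cong_trans cong_dvd_modulus)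
next
  case False
  then show ?thesis
    using assms unfolding residue_class_def
    by (auto dest: cong_dvd_modulus[OF _ assms]) (meson cong_sym cong_trans cong_dvd_modulus)
qed

lemma prob_residue_class:
  assumes "d > 0" "d dvd N" "N > 0"
  shows "prob (pmf_of_set {0..<N}) (residue_class d s) = 1 / real_of_int d"
proof -
  obtain t where t: "N = d * t" using assms(2) by (elim dvdE)
  have tp: "t > 0" using assms t by (simp add: zero_less_mult_iff)
  have "{0..<N} \<inter> residue_class d s = (\<lambda>y. s mod d + d * y) ` {0..<t}"
  proof (intro equalityI subsetI)
    fix x assume "x \<in> {0..<N} \<inter> residue_class d s"
    then have x: "0 \<le> x" "x < d * t" "x mod d = s mod d"
      unfolding residue_class_def t by (auto simp: unique_euclidean_semiring_class.cong_def Int_iff atLeastLessThan_iff mem_Collect_eq)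
    have "x = s mod d + d * (x div d)"
      using x(3) by (metis mod_mult_div_eq)
    moreover have "d * (x div d) \<le> x"
      using assms(1) by (metis mult_div_mod_eq le_add_same_cancel1 pos_mod_sign)
    with x have "d * (x div d) < d * t"
      by linarith
    with x assms(1) have "x div d \<in> {0..<t}"
      by (simp add: pos_imp_zdiv_nonneg_iff)
    ultimately show "x \<in> (\<lambda>y. s mod d + d * y) ` {0..<t}" by blast
  next
    fix x assume "x \<in> (\<lambda>y. s mod d + d * y) ` {0..<t}"
    then obtain y where y: "0 \<le> y" "y < t" "x = s mod d + d * y" by auto
    have "d * (y + 1) \<le> d * t"
      using y assms(1) by (intro mult_left_mono) auto
    then have "x < d * t"
      using y(3) pos_mod_bound[OF assms(1), of s] by (simp add: algebra_simps)
    moreover have "0 \<le> x"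
      using y assms(1) by simp
    ultimately show "x \<in> {0..<N} \<inter> residue_class d s"
      using y(3) by (auto simp: residue_class_def unique_euclidean_semiring_class.cong_def t)
  qed
  moreover have "inj_on (\<lambda>y. s mod d + d * y) {0..<t}"
    using assms(1) by (auto simp: inj_on_def)
  ultimately have "card ({0..<N} \<inter> residue_class d s) = nat t"
    by (simp add: card_image)
  moreover have "{0..<N} \<noteq> {}" using assms by auto
  ultimately show ?thesis
    using assms tp t by (simp add: measure_pmf_of_set)
qed

text \<open>If one distinguished term \<open>d\<close> stays below its bound by \<open>g\<close>, so does the whole sum.  An absent
  \<open>d\<close> counts as a term equal to \<open>0\<close>; this treats a missing modulus on the same footing as a
  modulus whose class is wasted on an overlap.\<close>

lemma sum_le_minus_gain:
  fixes f w :: "'a \<Rightarrow> real"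
  assumes "finite F" "\<And>e. e \<in> F \<Longrightarrow> f e \<le> w e" "sum w (insert d F) \<le> s"
    and "d \<in> F \<Longrightarrow> f d \<le> w d - g" "d \<notin> F \<Longrightarrow> g \<le> w d"
  shows "sum f F \<le> s - g"
proof (cases "d \<in> F")
  case True
  then have "sum f F = f d + sum f (F - {d})" "sum w (insert d F) = w d + sum w (F - {d})"
    using assms(1) by (simp_all add: sum.remove insert_absorb)
  moreover have "sum f (F - {d}) \<le> sum w (F - {d})"
    using assms(2) by (intro sum_mono) auto
  ultimately show ?thesis
    using assms(3) assms(4)[OF True] by linarith
next
  case False
  have "sum f F \<le> sum w F"
    using assms(2) by (rule sum_mono)
  moreover have "sum w (insert d F) = w d + sum w F"
    using False assms(1) by simp
  ultimately show ?thesis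
    using assms(3) assms(5)[OF False] by linarith
qed

section \<open>The slack of 1/480\<close>

text \<open>The covering inequality and upper bounds for its three main terms, with the gains \<open>g1, g2, g3\<close>
  over the trivial bounds.  For the extreme values \<open>1/8, 1/18, 1/20\<close> of \<open>x2, x3, x5\<close> the trivial bounds
  exceed what is needed by \<open>2267/2880 - 2261/2880 = 1/480\<close>, and smaller values only help: each
  deficit makes the left-hand side of the covering inequality grow faster than the right-hand side.
  For \<open>x2\<close> a part of this effect is kept in the conclusion, because in \<open>no_smooth_cover\<close> a small \<open>X2\<close> also
  leaves more room to \<open>X25\<close>.\<close>

lemma gains_le_slack_real:
  fixes x2 x3 x5 t1 t2 t3 g1 g2 g3 :: real
  assumes "0 \<le> x2" "x2 \<le> 1 / 8" "0 \<le> x3" "x3 \<le> 1 / 18" "0 \<le> x5" "x5 \<le> 1 / 20"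
    and "(1 - x2) * (1 - x3) * (1 - x5) \<le> t1 + t2 + t3 + 1 / 8"
    and "t1 \<le> (1 - x5) / 3 - g1" "t2 \<le> (1 - x3) / 4 - g2" "t3 \<le> (1 - x2) / 8 - g3"
  shows "g1 + g2 + g3 + 1 / 4 * (1 / 8 - x2) \<le> 1 / 480"
proof -
  define d2 where "d2 = 1 / 8 - x2"
  define d3 where "d3 = 1 / 18 - x3"
  define d5 where "d5 = 1 / 20 - x5"
  have d: "0 \<le> d2" "0 \<le> d3" "0 \<le> d5"
    using assms by (simp_all add: d2_def d3_def d5_def)
  have "0 \<le> d2 * d3" "0 \<le> d2 * d5" "0 \<le> d3 * d5" "0 \<le> d2 * d3 * d5"
    using d by simp_all
  moreover have "(1 - x2) * (1 - x3) * (1 - x5) = (7 / 8 + d2) * (17 / 18 + d3) * (19 / 20 + d5)"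
    by (simp add: d2_def d3_def d5_def)
  moreover have "(7 / 8 + d2) * (17 / 18 + d3) * (19 / 20 + d5)
      = 2261 / 2880 + 323 / 360 * d2 + 133 / 160 * d3 + 119 / 144 * d5
        + 19 / 20 * (d2 * d3) + 17 / 18 * (d2 * d5) + 7 / 8 * (d3 * d5) + d2 * d3 * d5"
    by (simp add: field_simps)
  ultimately have "2261 / 2880 + 323 / 360 * d2 + 133 / 160 * d3 + 119 / 144 * d5 \<le> t1 + t2 + t3 + 1 / 8"
    using assms(7) by linarith
  moreover have "x2 = 1 / 8 - d2" "x3 = 1 / 18 - d3" "x5 = 1 / 20 - d5"
    by (simp_all add: d2_def d3_def d5_def)
  ultimately show ?thesis
    using assms(8-10) d by (simp add: field_simps)
qed

section \<open>Splitting a cover by the prime divisors of its moduli\<close>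

text \<open>A cover with least modulus at least \<open>10\<close>, seen in coordinates.  The set \<open>S\<close> holds the exponents of
  the moduli, \<open>\<rho> e\<close> is the residue used for the modulus with exponents \<open>e\<close>, and \<open>p\<close>, \<open>q\<close>, \<open>r\<close> model
  the uniform distributions modulo large powers of \<open>2\<close>, \<open>3\<close>, \<open>5\<close>; all that matters about them
  is that they give the classes occurring here their natural densities.  The aim is to refute
  these assumptions.\<close>

locale smooth_cover =
  fixes p q r :: "int pmf" and S :: "(nat \<times> nat \<times> nat) set" and \<rho> :: "nat \<times> nat \<times> nat \<Rightarrow> int"
  assumes finite_S: "finite S"
    and modulus_ge_10: "(a, b, c) \<in> S \<Longrightarrow> 10 \<le> 2 ^ a * 3 ^ b * (5 ^ c :: nat)"
    and prob_2: "(a, b, c) \<in> S \<Longrightarrow> prob p (residue_class (2 ^ a) s) = 1 / 2 ^ a"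
    and prob_3: "(a, b, c) \<in> S \<Longrightarrow> prob q (residue_class (3 ^ b) s) = 1 / 3 ^ b"
    and prob_5: "(a, b, c) \<in> S \<Longrightarrow> prob r (residue_class (5 ^ c) s) = 1 / 5 ^ c"
    and cover: "\<exists>(a, b, c)\<in>S. i \<in> residue_class (2 ^ a) (\<rho> (a, b, c))
      \<and> j \<in> residue_class (3 ^ b) (\<rho> (a, b, c)) \<and> k \<in> residue_class (5 ^ c) (\<rho> (a, b, c))"
begin

definition "U e = residue_class (2 ^ fst e) (\<rho> e)"
definition "V e = residue_class (3 ^ fst (snd e)) (\<rho> e)"
definition "W e = residue_class (5 ^ snd (snd e)) (\<rho> e)"

definition "S2 = S \<inter> {1..} \<times> {0} \<times> {0}"
definition "S3 = S \<inter> {0} \<times> {1..} \<times> {0}"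
definition "S5 = S \<inter> {0} \<times> {0} \<times> {1..}"
definition "S23 = S \<inter> {1..} \<times> {1..} \<times> {0}"
definition "S25 = S \<inter> {1..} \<times> {0} \<times> {1..}"
definition "S35 = S \<inter> {0} \<times> {1..} \<times> {1..}"
definition "S235 = S \<inter> {1..} \<times> {1..} \<times> {1..}"

definition "X2 = (\<Union>e\<in>S2. U e)"
definition "X3 = (\<Union>e\<in>S3. V e)"
definition "X5 = (\<Union>e\<in>S5. W e)"
definition "X23 = (\<Union>e\<in>S23. U e \<times> V e)"
definition "X25 = (\<Union>e\<in>S25. U e \<times> W e)"
definition "X35 = (\<Union>e\<in>S35. V e \<times> W e)"
definition "X235 = (\<Union>e\<in>S235. U e \<times> V e \<times> W e)"

lemma finite_parts: "finite S2" "finite S3" "finite S5" "finite S23" "finite S25" "finite S35" "finite S235"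
  using finite_S by (simp_all add: S2_def S3_def S5_def S23_def S25_def S35_def S235_def)

lemma parts_subset: "S2 \<subseteq> S" "S3 \<subseteq> S" "S5 \<subseteq> S" "S23 \<subseteq> S" "S25 \<subseteq> S" "S35 \<subseteq> S" "S235 \<subseteq> S"
  by (auto simp add: S2_def S3_def S5_def S23_def S25_def S35_def S235_def)

text \<open>The bound \<open>10\<close> is felt by the prime powers, which start at \<open>16\<close>, \<open>27\<close> and \<open>25\<close>, and in the
  \<open>{2, 3}\<close>-part only by the absence of \<open>6\<close>.\<close>

lemma S2_subset: "S2 \<subseteq> {4..} \<times> {0} \<times> {0}"
proof
  fix e assume e: "e \<in> S2"
  then obtain a where a: "e = (a, 0, 0)" "(a, 0, 0) \<in> S" by (auto simp: S2_def)
  have "\<not> a \<le> 3"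
  proof
    assume "a \<le> 3"
    then have "(2::nat) ^ a \<le> 2 ^ 3" by (intro power_increasing) auto
    then show False using modulus_ge_10[OF a(2)] by simp
  qed
  then show "e \<in> {4..} \<times> {0} \<times> {0}" using a by auto
qed

lemma S3_subset: "S3 \<subseteq> {0} \<times> {3..} \<times> {0}"
proof
  fix e assume e: "e \<in> S3"
  then obtain a where a: "e = (0, a, 0)" "(0, a, 0) \<in> S" by (auto simp: S3_def)
  have "\<not> a \<le> 2"
  proof
    assume "a \<le> 2"
    then have "(3::nat) ^ a \<le> 3 ^ 2" by (intro power_increasing) auto
    then show False using modulus_ge_10[OF a(2)] by simp
  qed
  then show "e \<in> {0} \<times> {3..} \<times> {0}" using a by auto
qed

lemma S5_subset: "S5 \<subseteq> {0} \<times> {0} \<times> {2..}"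
proof
  fix e assume e: "e \<in> S5"
  then obtain a where a: "e = (0, 0, a)" "(0, 0, a) \<in> S" by (auto simp: S5_def)
  have "\<not> a \<le> 1"
  proof
    assume "a \<le> 1"
    then have "(5::nat) ^ a \<le> 5 ^ 1" by (intro power_increasing) auto
    then show False using modulus_ge_10[OF a(2)] by simp
  qed
  then show "e \<in> {0} \<times> {0} \<times> {2..}" using a by auto
qed

lemma prob_U: "e \<in> S \<Longrightarrow> prob p (U e) = 1 / 2 ^ fst e"
  using prob_2[of "fst e" "fst (snd e)" "snd (snd e)"] by (simp add: U_def)

lemma prob_V: "e \<in> S \<Longrightarrow> prob q (V e) = 1 / 3 ^ fst (snd e)"
  using prob_3[of "fst e" "fst (snd e)" "snd (snd e)"] by (simp add: V_def)

lemma prob_W: "e \<in> S \<Longrightarrow> prob r (W e) = 1 / 5 ^ snd (snd e)"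
  using prob_5[of "fst e" "fst (snd e)" "snd (snd e)"] by (simp add: W_def)

lemma weight_eq: "weight e = 1 / 2 ^ fst e * (1 / 3 ^ fst (snd e) * (1 / 5 ^ snd (snd e)))"
  by (simp add: weight_def case_prod_unfold)

lemma prob_X2: "prob p X2 \<le> 1 / 8"
proof -
  have "prob p X2 \<le> (\<Sum>e\<in>S2. prob p (U e))"
    unfolding X2_def by (rule prob_UN_le) (rule finite_parts)
  also have "\<dots> = sum weight S2"
    using parts_subset by (intro sum.cong) (auto simp: prob_U weight_eq S2_def)
  also have "\<dots> \<le> 2 / 2 ^ 4 * (1 * 1)"
    by (rule sum_weight_le[OF finite_parts(1) S2_subset];
      (rule sum_powers_2 sum_powers_3 sum_powers_5 sum_powers_0; assumption))
  finally show ?thesis by simp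
qed

lemma prob_X3: "prob q X3 \<le> 1 / 18"
proof -
  have "prob q X3 \<le> (\<Sum>e\<in>S3. prob q (V e))"
    unfolding X3_def by (rule prob_UN_le) (rule finite_parts)
  also have "\<dots> = sum weight S3"
    using parts_subset by (intro sum.cong) (auto simp: prob_V weight_eq S3_def)
  also have "\<dots> \<le> 1 * (3 / (2 * 3 ^ 3) * 1)"
    by (rule sum_weight_le[OF finite_parts(2) S3_subset];
      (rule sum_powers_2 sum_powers_3 sum_powers_5 sum_powers_0; assumption))
  finally show ?thesis by simp
qed

lemma prob_X5: "prob r X5 \<le> 1 / 20"
proof -
  have "prob r X5 \<le> (\<Sum>e\<in>S5. prob r (W e))"
    unfolding X5_def by (rule prob_UN_le) (rule finite_parts)
  also have "\<dots> = sum weight S5"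
    using parts_subset by (intro sum.cong) (auto simp: prob_W weight_eq S5_def)
  also have "\<dots> \<le> 1 * (1 * (5 / (4 * 5 ^ 2)))"
    by (rule sum_weight_le[OF finite_parts(3) S5_subset];
      (rule sum_powers_2 sum_powers_3 sum_powers_5 sum_powers_0; assumption))
  finally show ?thesis by simp
qed

lemma prob_X235: "prob (pair_pmf p (pair_pmf q r)) X235 \<le> 1 / 8"
proof -
  have fin: "finite (S235)" using finite_parts by simp
  have sub: "S235 \<subseteq> {1..} \<times> {1..} \<times> {1..}"
    by (auto simp: S23_def S25_def S35_def S235_def)
  have "prob (pair_pmf p (pair_pmf q r)) X235
      \<le> (\<Sum>e\<in>S235. prob (pair_pmf p (pair_pmf q r)) (U e \<times> V e \<times> W e))"
    unfolding X235_def by (rule prob_UN_le) (rule finite_parts)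
  also have "\<dots> = sum weight S235"
    using parts_subset
    by (intro sum.cong) (auto simp: prob_times prob_U prob_V prob_W weight_eq)
  also have "\<dots> \<le> 2 / 2 ^ 1 * (3 / (2 * 3 ^ 1) * (5 / (4 * 5 ^ 1)))"
    by (rule sum_weight_le[OF fin sub];
      (rule sum_powers_2 sum_powers_3 sum_powers_5 sum_powers_0; assumption))
  finally show ?thesis by simp
qed

text \<open>Without the restriction on the least modulus the bound would be \<open>1/2\<close>; the difference is the
  weight of the modulus \<open>6\<close>.\<close>

lemma sum_weight_S23: "sum weight S23 \<le> 1 / 3"
proof -
  have notin: "(1, 1, 0) \<notin> S23"
    using modulus_ge_10[of 1 1 0] by (auto simp: S23_def)
  have fin: "finite (insert (1, 1, 0) S23)" using finite_parts by simp
  have sub: "insert (1, 1, 0) S23 \<subseteq> {1..} \<times> {1..} \<times> {0}"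
    by (auto simp: S23_def S25_def S35_def S235_def)
  have "sum weight (insert (1, 1, 0) S23) \<le> 2 / 2 ^ 1 * (3 / (2 * 3 ^ 1) * 1)"
    by (rule sum_weight_le[OF fin sub];
      (rule sum_powers_2 sum_powers_3 sum_powers_5 sum_powers_0; assumption))
  then show ?thesis
    using notin finite_parts by (simp add: weight_def)
qed

text \<open>The bound must include \<open>d\<close> even if the cover does not use this modulus, since its whole weight then
  counts as a gain.\<close>

lemma sum_weight_S25: "d \<in> {1..} \<times> {0} \<times> {1..} \<Longrightarrow> sum weight (insert d S25) \<le> 1 / 4"
proof -
  assume d: "d \<in> {1..} \<times> {0} \<times> {1..}"
  have fin: "finite (insert d S25)" using finite_parts by simp
  have sub: "insert d S25 \<subseteq> {1..} \<times> {0} \<times> {1..}"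
    using d by (auto simp: S23_def S25_def S35_def S235_def)
  have "sum weight (insert d S25) \<le> 2 / 2 ^ 1 * (1 * (5 / (4 * 5 ^ 1)))"
    by (rule sum_weight_le[OF fin sub];
      (rule sum_powers_2 sum_powers_3 sum_powers_5 sum_powers_0; assumption))
  then show ?thesis by simp
qed

lemma sum_weight_S35: "d \<in> {0} \<times> {1..} \<times> {1..} \<Longrightarrow> sum weight (insert d S35) \<le> 1 / 8"
proof -
  assume d: "d \<in> {0} \<times> {1..} \<times> {1..}"
  have fin: "finite (insert d S35)" using finite_parts by simp
  have sub: "insert d S35 \<subseteq> {0} \<times> {1..} \<times> {1..}"
    using d by (auto simp: S23_def S25_def S35_def S235_def)
  have "sum weight (insert d S35) \<le> 1 * (3 / (2 * 3 ^ 1) * (5 / (4 * 5 ^ 1)))"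
    by (rule sum_weight_le[OF fin sub];
      (rule sum_powers_2 sum_powers_3 sum_powers_5 sum_powers_0; assumption))
  then show ?thesis by simp
qed

lemma every_point_covered:
  "i \<in> X2 \<or> j \<in> X3 \<or> k \<in> X5 \<or> (i, j) \<in> X23 \<or> (i, k) \<in> X25 \<or> (j, k) \<in> X35 \<or> (i, j, k) \<in> X235"
proof -
  obtain a b c where e: "(a, b, c) \<in> S" "i \<in> U (a, b, c)" "j \<in> V (a, b, c)" "k \<in> W (a, b, c)"
    using cover[of i j k] by (auto simp: U_def V_def W_def)
  have "(0, 0, 0) \<notin> S"
    using modulus_ge_10[of 0 0 0] by auto
  then consider "(a, b, c) \<in> S2" | "(a, b, c) \<in> S3" | "(a, b, c) \<in> S5" | "(a, b, c) \<in> S23"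
    | "(a, b, c) \<in> S25" | "(a, b, c) \<in> S35" | "(a, b, c) \<in> S235"
    using e(1) unfolding S2_def S3_def S5_def S23_def S25_def S35_def S235_def
    by (simp add: Suc_le_eq) (metis neq0_conv)
  then show ?thesis
  proof cases
    case 1
    then have "i \<in> X2" using e by (auto simp: X2_def)
    then show ?thesis by simp
  next
    case 2
    then have "j \<in> X3" using e by (auto simp: X3_def)
    then show ?thesis by simp
  next
    case 3
    then have "k \<in> X5" using e by (auto simp: X5_def)
    then show ?thesis by simp
  next
    case 4
    then have "(i, j) \<in> X23" using e by (auto simp: X23_def)
    then show ?thesis by simp
  next
    case 5
    then have "(i, k) \<in> X25" using e by (auto simp: X25_def)
    then show ?thesis by simp
  next
    case 6
    then have "(j, k) \<in> X35" using e by (auto simp: X35_def)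
    then show ?thesis by simp
  next
    case 7
    then have "(i, j, k) \<in> X235" using e by (auto simp: X235_def)
    then show ?thesis by simp
  qed
qed

lemma nested_U: "fst d \<le> fst e \<Longrightarrow> U e \<subseteq> U d \<or> U e \<inter> U d = {}"
  unfolding U_def by (intro residue_classes_nested_or_disjoint le_imp_power_dvd)

lemma nested_V: "fst (snd d) \<le> fst (snd e) \<Longrightarrow> V e \<subseteq> V d \<or> V e \<inter> V d = {}"
  unfolding V_def by (intro residue_classes_nested_or_disjoint le_imp_power_dvd)

lemma nested_W: "snd (snd d) \<le> snd (snd e) \<Longrightarrow> W e \<subseteq> W d \<or> W e \<inter> W d = {}"
  unfolding W_def by (intro residue_classes_nested_or_disjoint le_imp_power_dvd)

abbreviation "P23 \<equiv> prob (pair_pmf p q)"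
abbreviation "P25 \<equiv> prob (pair_pmf p r)"
abbreviation "P35 \<equiv> prob (pair_pmf q r)"
abbreviation "P235 \<equiv> prob (pair_pmf p (pair_pmf q r))"

text \<open>The sets \<open>Y25\<close> and \<open>Y35\<close> are what \<open>X25\<close> and \<open>X35\<close> contribute beyond the prime powers that
  share a coordinate with them.  Points not covered by prime powers or by \<open>X235\<close> are assigned to
  \<open>T3\<close>, \<open>T2\<close>, \<open>T1\<close> in this order of preference: any overlap with \<open>X35\<close> is thus a loss for \<open>T1\<close> or
  \<open>T2\<close>, and any overlap of \<open>X23\<close> with \<open>X25\<close> a loss for \<open>T1\<close>.\<close>

definition "Y25 = X25 - {(i, k). i \<in> X2 \<or> k \<in> X5}"
definition "Y35 = X35 - {(j, k). j \<in> X3 \<or> k \<in> X5}"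
definition "T1 = {(i, j, k). (i, j) \<in> X23 \<and> i \<notin> X2 \<and> j \<notin> X3 \<and> k \<notin> X5 \<and> (i, k) \<notin> X25 \<and> (j, k) \<notin> X35}"
definition "T2 = {(i, j, k). (i, k) \<in> Y25 \<and> j \<notin> X3 \<and> (j, k) \<notin> X35}"
definition "T3 = {(i, j, k). i \<notin> X2 \<and> (j, k) \<in> Y35}"

lemma cover_inequality:
  "(1 - prob p X2) * (1 - prob q X3) * (1 - prob r X5) \<le> P235 T1 + P235 T2 + P235 T3 + 1 / 8"
proof -
  have "(1 - prob p X2) * (1 - prob q X3) * (1 - prob r X5) = P235 ((- X2) \<times> (- X3) \<times> (- X5))"
    by (simp add: prob_times prob_Compl)
  also have "\<dots> \<le> P235 (((T1 \<union> T2) \<union> T3) \<union> X235)"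
    using every_point_covered by (intro prob_mono) (auto simp: T1_def T2_def T3_def Y25_def Y35_def)
  also have "\<dots> \<le> P235 T1 + P235 T2 + P235 T3 + P235 X235"
    by (intro order_trans[OF prob_Un_le] add_mono order_refl)
  finally show ?thesis
    using prob_X235 by linarith
qed

lemma prob_X23: "P23 X23 \<le> 1 / 3"
proof -
  have "P23 X23 \<le> (\<Sum>e\<in>S23. P23 (U e \<times> V e))"
    unfolding X23_def by (rule prob_UN_le) (rule finite_parts)
  also have "\<dots> = sum weight S23"
    using parts_subset by (intro sum.cong) (auto simp: prob_times prob_U prob_V weight_eq S23_def)
  finally show ?thesis using sum_weight_S23 by simp
qed

lemma prob_T1: "P235 T1 \<le> (1 - prob r X5) / 3"
proof -
  have "P235 T1 \<le> P235 {(i, j, k). (i, j) \<in> X23 \<and> k \<in> - X5}"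
    by (intro prob_mono) (auto simp: T1_def)
  also have "\<dots> = P23 X23 * (1 - prob r X5)"
    by (simp only: prob_cylinder_12 prob_Compl)
  also have "\<dots> \<le> 1 / 3 * (1 - prob r X5)"
    by (intro mult_right_mono prob_X23) simp
  finally show ?thesis by simp
qed

lemma prob_T2: "P235 T2 \<le> (1 - prob q X3) * P25 Y25"
proof -
  have "P235 T2 \<le> P235 {(i, j, k). (i, k) \<in> Y25 \<and> j \<in> - X3}"
    by (intro prob_mono) (auto simp: T2_def)
  then show ?thesis
    by (simp only: prob_cylinder_13 prob_Compl mult.commute)
qed

lemma prob_T3: "P235 T3 = (1 - prob p X2) * P35 Y35"
proof -
  have "T3 = {(i, j, k). i \<in> - X2 \<and> (j, k) \<in> Y35}"
    by (auto simp: T3_def)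
  then show ?thesis
    by (simp only: prob_cylinder_23 prob_Compl)
qed

text \<open>The gain \<open>g\<close> is what the modulus \<open>d\<close> wastes by its overlap with \<open>X2\<close> and \<open>X5\<close>, or its whole
  weight if it does not occur.\<close>

lemma prob_Y25:
  assumes "d \<in> {1..} \<times> {0} \<times> {1..}" "g \<le> weight d"
    and "d \<in> S \<Longrightarrow> P25 (U d \<times> W d - {(i, k). i \<in> X2 \<or> k \<in> X5}) \<le> weight d - g"
  shows "P25 Y25 \<le> 1 / 4 - g"
proof -
  have "Y25 = (\<Union>e\<in>S25. U e \<times> W e - {(i, k). i \<in> X2 \<or> k \<in> X5})"
    by (auto simp: Y25_def X25_def)
  then have "P25 Y25 \<le> (\<Sum>e\<in>S25. P25 (U e \<times> W e - {(i, k). i \<in> X2 \<or> k \<in> X5}))"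
    by (simp only: prob_UN_le[OF finite_parts(5)])
  also have "\<dots> \<le> 1 / 4 - g"
  proof (rule sum_le_minus_gain[OF finite_parts(5) _ sum_weight_S25[OF assms(1)]])
    fix e assume e: "e \<in> S25"
    have "P25 (U e \<times> W e - {(i, k). i \<in> X2 \<or> k \<in> X5}) \<le> P25 (U e \<times> W e)"
      by (rule prob_mono) auto
    also have "\<dots> = weight e"
      using e parts_subset by (auto simp: prob_times prob_U prob_W weight_eq S25_def)
    finally show "P25 (U e \<times> W e - {(i, k). i \<in> X2 \<or> k \<in> X5}) \<le> weight e" .
  qed (use assms in \<open>auto simp: S25_def\<close>)
  finally show ?thesis .
qed

lemma prob_Y35:
  assumes "d \<in> {0} \<times> {1..} \<times> {1..}" "g \<le> weight d"
    and "d \<in> S \<Longrightarrow> P35 (V d \<times> W d - {(j, k). j \<in> X3 \<or> k \<in> X5}) \<le> weight d - g"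
  shows "P35 Y35 \<le> 1 / 8 - g"
proof -
  have "Y35 = (\<Union>e\<in>S35. V e \<times> W e - {(j, k). j \<in> X3 \<or> k \<in> X5})"
    by (auto simp: Y35_def X35_def)
  then have "P35 Y35 \<le> (\<Sum>e\<in>S35. P35 (V e \<times> W e - {(j, k). j \<in> X3 \<or> k \<in> X5}))"
    by (simp only: prob_UN_le[OF finite_parts(6)])
  also have "\<dots> \<le> 1 / 8 - g"
  proof (rule sum_le_minus_gain[OF finite_parts(6) _ sum_weight_S35[OF assms(1)]])
    fix e assume e: "e \<in> S35"
    have "P35 (V e \<times> W e - {(j, k). j \<in> X3 \<or> k \<in> X5}) \<le> P35 (V e \<times> W e)"
      by (rule prob_mono) auto
    also have "\<dots> = weight e"
      using e parts_subset by (auto simp: prob_times prob_V prob_W weight_eq S35_def)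
    finally show "P35 (V e \<times> W e - {(j, k). j \<in> X3 \<or> k \<in> X5}) \<le> weight e" .
  qed (use assms in \<open>auto simp: S35_def\<close>)
  finally show ?thesis .
qed

lemma prob_Y25_le: "P25 Y25 \<le> 1 / 4"
proof -
  have "P25 Y25 \<le> (\<Sum>e\<in>S25. P25 (U e \<times> W e))"
    using prob_UN_le[OF finite_parts(5), of "pair_pmf p r" "\<lambda>e. U e \<times> W e"]
      prob_mono[of Y25 X25 "pair_pmf p r"] by (simp add: Y25_def X25_def)
  also have "\<dots> = sum weight S25"
    using parts_subset by (intro sum.cong) (auto simp: prob_times prob_U prob_W weight_eq S25_def)
  also have "\<dots> \<le> sum weight (insert (1, 0, 1) S25)"
    using finite_parts by (intro sum_mono2) (auto simp: weight_def)
  also have "\<dots> \<le> 1 / 4"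
    by (rule sum_weight_S25) auto
  finally show ?thesis .
qed

lemma prob_Y35_le: "P35 Y35 \<le> 1 / 8"
proof -
  have "P35 Y35 \<le> (\<Sum>e\<in>S35. P35 (V e \<times> W e))"
    using prob_UN_le[OF finite_parts(6), of "pair_pmf q r" "\<lambda>e. V e \<times> W e"]
      prob_mono[of Y35 X35 "pair_pmf q r"] by (simp add: Y35_def X35_def)
  also have "\<dots> = sum weight S35"
    using parts_subset by (intro sum.cong) (auto simp: prob_times prob_V prob_W weight_eq S35_def)
  also have "\<dots> \<le> sum weight (insert (0, 1, 1) S35)"
    using finite_parts by (intro sum_mono2) (auto simp: weight_def)
  also have "\<dots> \<le> 1 / 8"
    by (rule sum_weight_S35) auto
  finally show ?thesis .
qed

text \<open>The factor \<open>7/8\<close> is the least possible measure of the complement of \<open>X2\<close>, which is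
  independent of \<open>X35\<close>.\<close>

lemma gains_le_slack:
  assumes "P235 T1 \<le> (1 - prob r X5) / 3 - g1"
    and "P235 T2 \<le> (1 - prob q X3) / 4 - g2"
    and "P35 Y35 \<le> 1 / 8 - g3" "0 \<le> g3"
  shows "g1 + g2 + 7 / 8 * g3 + 1 / 4 * (1 / 8 - prob p X2) \<le> 1 / 480"
proof -
  have "P235 T3 \<le> (1 - prob p X2) * (1 / 8 - g3)"
    unfolding prob_T3 using assms(3) by (intro mult_left_mono) auto
  also have "\<dots> = (1 - prob p X2) / 8 - (1 - prob p X2) * g3"
    by (simp add: right_diff_distrib)
  also have "\<dots> \<le> (1 - prob p X2) / 8 - 7 / 8 * g3"
    using prob_X2 assms(4) by (intro diff_left_mono mult_right_mono) auto
  finally show ?thesis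
    by (intro gains_le_slack_real[OF _ prob_X2 _ prob_X3 _ prob_X5 cover_inequality assms(1,2)]) simp_all
qed

lemma gain_25_le_slack:
  assumes "P25 Y25 \<le> 1 / 4 - g" "0 \<le> g"
  shows "17 / 18 * g \<le> 1 / 480"
proof -
  have "P235 T2 \<le> (1 - prob q X3) * (1 / 4 - g)"
    using assms(1) by (intro order_trans[OF prob_T2] mult_left_mono) auto
  also have "\<dots> = (1 - prob q X3) / 4 - (1 - prob q X3) * g"
    by (simp add: right_diff_distrib)
  also have "\<dots> \<le> (1 - prob q X3) / 4 - 17 / 18 * g"
    using prob_X3 assms(2) by (intro diff_left_mono mult_right_mono) auto
  finally have "0 + 17 / 18 * g + 7 / 8 * 0 + 1 / 4 * (1 / 8 - prob p X2) \<le> 1 / 480"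
    using prob_T1 prob_Y35_le by (intro gains_le_slack) simp_all
  then show ?thesis
    using prob_X2 by argo
qed

lemma gain_35_le_slack:
  assumes "P35 Y35 \<le> 1 / 8 - g" "0 \<le> g"
  shows "g \<le> 1 / 420"
proof -
  have "P235 T2 \<le> (1 - prob q X3) * (1 / 4)"
    by (intro order_trans[OF prob_T2] mult_left_mono prob_Y25_le) auto
  then have "0 + 0 + 7 / 8 * g + 1 / 4 * (1 / 8 - prob p X2) \<le> 1 / 480"
    using prob_T1 assms by (intro gains_le_slack) simp_all
  then show ?thesis
    using prob_X2 by argo
qed

section \<open>The moduli 10, 15 and 45\<close>

definition e10 :: "nat \<times> nat \<times> nat" where "e10 = (1, 0, 1)"
definition e15 :: "nat \<times> nat \<times> nat" where "e15 = (0, 1, 1)"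
definition e45 :: "nat \<times> nat \<times> nat" where "e45 = (0, 2, 1)"

text \<open>The absence of the modulus \<open>10\<close>, \<open>15\<close> or \<open>45\<close> would cost about its weight, at least \<open>1/45\<close>, which
  is more than the slack allows.\<close>

lemma modulus_10_occurs: "e10 \<in> S"
proof (rule ccontr)
  assume "e10 \<notin> S"
  then have "P25 Y25 \<le> 1 / 4 - 1 / 10"
    by (intro prob_Y25[of e10]) (auto simp: weight_def e10_def e15_def e45_def)
  then show False using gain_25_le_slack[of "1 / 10"] by simp
qed

lemma modulus_15_occurs: "e15 \<in> S"
proof (rule ccontr)
  assume "e15 \<notin> S"
  then have "P35 Y35 \<le> 1 / 8 - 1 / 15"
    by (intro prob_Y35[of e15]) (auto simp: weight_def e10_def e15_def e45_def)
  then show False using gain_35_le_slack[of "1 / 15"] by simp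
qed

lemma modulus_45_occurs: "e45 \<in> S"
proof (rule ccontr)
  assume "e45 \<notin> S"
  then have "P35 Y35 \<le> 1 / 8 - 1 / 45"
    by (intro prob_Y35[of e45]) (auto simp: weight_def e10_def e15_def e45_def)
  then show False using gain_35_le_slack[of "1 / 45"] by simp
qed

lemma weight_10_15_45: "weight e10 = 1 / 10" "weight e15 = 1 / 15" "weight e45 = 1 / 45"
  by (simp_all add: weight_def e10_def e15_def e45_def)

lemma exponents_in_parts: "e10 \<in> S25" "e15 \<in> S35" "e45 \<in> S35"
  using modulus_10_occurs modulus_15_occurs modulus_45_occurs by (simp_all add: S25_def S35_def e10_def e15_def e45_def)

lemma prob_coordinates_10_15_45: "prob p (U e10) = 1 / 2" "prob r (W e10) = 1 / 5"
  "prob q (V e15) = 1 / 3" "prob r (W e15) = 1 / 5"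
  "prob q (V e45) = 1 / 9" "prob r (W e45) = 1 / 5"
  using prob_U[OF modulus_10_occurs] prob_W[OF modulus_10_occurs] prob_V[OF modulus_15_occurs] prob_W[OF modulus_15_occurs]
    prob_V[OF modulus_45_occurs] prob_W[OF modulus_45_occurs]
  by (simp_all add: e10_def e15_def e45_def)

text \<open>The classes modulo \<open>10\<close>, \<open>15\<close> and \<open>45\<close> serve as obstacles for other classes.  As an obstacle
  only their part outside the prime powers counts, so the overlap with these is bounded here: an
  overlap of \<open>t\<close> in one coordinate wastes \<open>t\<close> times the density in the other coordinate.\<close>

lemma prob_W15_X5: "prob r (W e15 \<inter> X5) \<le> 1 / 100"
proof -
  let ?t = "prob r (W e15 \<inter> X5)"
  have t: "prob r (W e15 - X5) = 1 / 5 - ?t"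
    using prob_Int_Diff[of r "W e15" X5] prob_coordinates_10_15_45 by simp
  have "P35 (V e15 \<times> W e15 - {(j, k). j \<in> X3 \<or> k \<in> X5}) \<le> P35 (V e15 \<times> (W e15 - X5))"
    by (rule prob_mono) auto
  also have "\<dots> = weight e15 - ?t / 3"
    by (simp add: prob_times prob_coordinates_10_15_45 t weight_10_15_45 right_diff_distrib)
  finally have le: "P35 (V e15 \<times> W e15 - {(j, k). j \<in> X3 \<or> k \<in> X5}) \<le> weight e15 - ?t / 3" .
  have "P35 Y35 \<le> 1 / 8 - ?t / 3"
  proof (rule prob_Y35[of e15])
    show "?t / 3 \<le> weight e15"
      using t measure_nonneg[of r "W e15 - X5"] unfolding weight_10_15_45 by linarith
  qed (use le in \<open>simp_all add: e10_def e15_def e45_def\<close>)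
  from gain_35_le_slack[OF this] show ?thesis by simp
qed

lemma prob_W10_X5: "prob r (W e10 \<inter> X5) \<le> 1 / 100"
proof -
  let ?t = "prob r (W e10 \<inter> X5)"
  have t: "prob r (W e10 - X5) = 1 / 5 - ?t"
    using prob_Int_Diff[of r "W e10" X5] prob_coordinates_10_15_45 by simp
  have "P25 (U e10 \<times> W e10 - {(i, k). i \<in> X2 \<or> k \<in> X5}) \<le> P25 (U e10 \<times> (W e10 - X5))"
    by (rule prob_mono) auto
  also have "\<dots> = weight e10 - ?t / 2"
    by (simp add: prob_times prob_coordinates_10_15_45 t weight_10_15_45 right_diff_distrib)
  finally have le: "P25 (U e10 \<times> W e10 - {(i, k). i \<in> X2 \<or> k \<in> X5}) \<le> weight e10 - ?t / 2" .
  have "P25 Y25 \<le> 1 / 4 - ?t / 2"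
  proof (rule prob_Y25[of e10])
    show "?t / 2 \<le> weight e10"
      using t measure_nonneg[of r "W e10 - X5"] unfolding weight_10_15_45 by linarith
  qed (use le in \<open>simp_all add: e10_def e15_def e45_def\<close>)
  from gain_25_le_slack[OF this] show ?thesis by simp
qed

lemma prob_V45_X3: "prob q (V e45 \<inter> X3) \<le> 1 / 50"
proof -
  let ?t = "prob q (V e45 \<inter> X3)"
  have t: "prob q (V e45 - X3) = 1 / 9 - ?t"
    using prob_Int_Diff[of q "V e45" X3] prob_coordinates_10_15_45 by simp
  have "P35 (V e45 \<times> W e45 - {(j, k). j \<in> X3 \<or> k \<in> X5}) \<le> P35 ((V e45 - X3) \<times> W e45)"
    by (rule prob_mono) auto
  also have "\<dots> = weight e45 - ?t / 5"
    by (simp add: prob_times prob_coordinates_10_15_45 t weight_10_15_45 right_diff_distrib)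
  finally have le: "P35 (V e45 \<times> W e45 - {(j, k). j \<in> X3 \<or> k \<in> X5}) \<le> weight e45 - ?t / 5" .
  have "P35 Y35 \<le> 1 / 8 - ?t / 5"
  proof (rule prob_Y35[of e45])
    show "?t / 5 \<le> weight e45"
      using t measure_nonneg[of q "V e45 - X3"] unfolding weight_10_15_45 by linarith
  qed (use le in \<open>simp_all add: e10_def e15_def e45_def\<close>)
  from gain_35_le_slack[OF this] show ?thesis by simp
qed

text \<open>For this overlap a bound derived from the slack alone would be too weak later on; the gain is
  kept instead and set against the loss it causes.\<close>

lemma prob_Y35_W45_X5: "P35 Y35 \<le> 1 / 8 - prob r (W e45 \<inter> X5) / 9"
proof -
  let ?t = "prob r (W e45 \<inter> X5)"
  have t: "prob r (W e45 - X5) = 1 / 5 - ?t"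
    using prob_Int_Diff[of r "W e45" X5] prob_coordinates_10_15_45 by simp
  have "P35 (V e45 \<times> W e45 - {(j, k). j \<in> X3 \<or> k \<in> X5}) \<le> P35 (V e45 \<times> (W e45 - X5))"
    by (rule prob_mono) auto
  also have "\<dots> = weight e45 - ?t / 9"
    by (simp add: prob_times prob_coordinates_10_15_45 t weight_10_15_45 right_diff_distrib)
  finally have le: "P35 (V e45 \<times> W e45 - {(j, k). j \<in> X3 \<or> k \<in> X5}) \<le> weight e45 - ?t / 9" .
  show ?thesis
  proof (rule prob_Y35[of e45])
    show "?t / 9 \<le> weight e45"
      using t measure_nonneg[of r "W e45 - X5"] unfolding weight_10_15_45 by linarith
  qed (use le in \<open>simp_all add: e10_def e15_def e45_def\<close>)
qed

section \<open>The rectangle left to the moduli with prime divisors 2 and 3\<close>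

definition "R = (- U e10) \<times> (- V e15)"

lemma prob_R: "P23 R = 1 / 3"
  by (simp add: R_def prob_times prob_Compl prob_coordinates_10_15_45)

text \<open>Moduli in this part are divisible by \<open>6\<close>, and \<open>R\<close> is a union of classes modulo \<open>6\<close>.\<close>

lemma S23_box_R: "e \<in> S23 \<Longrightarrow> U e \<times> V e \<subseteq> R \<or> U e \<times> V e \<inter> R = {}"
  using nested_U[of e10 e] nested_V[of e15 e]
  by (auto simp: S23_def R_def e10_def e15_def)

text \<open>Each class lies inside or outside \<open>R\<close>, and their total mass is at most \<open>1/3\<close>, the measure of \<open>R\<close>.
  So what leaves \<open>R\<close> leaves at least as much of \<open>R\<close> uncovered.\<close>

lemma prob_X23_outside_R: "P23 (X23 - R) \<le> P23 (R - X23)"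
proof -
  define G where "G = {e \<in> S23. U e \<times> V e \<subseteq> R}"
  have fin: "finite G" "finite (S23 - G)"
    using finite_parts by (auto simp: G_def)
  have "P23 (X23 \<inter> R) \<le> P23 (\<Union>e\<in>G. U e \<times> V e)"
    using S23_box_R by (intro prob_mono) (fastforce simp: X23_def G_def)
  also have "\<dots> \<le> (\<Sum>e\<in>G. P23 (U e \<times> V e))"
    by (rule prob_UN_le) (rule fin)
  finally have 1: "P23 (X23 \<inter> R) \<le> (\<Sum>e\<in>G. P23 (U e \<times> V e))" .
  have "P23 (X23 - R) \<le> P23 (\<Union>e\<in>S23 - G. U e \<times> V e)"
    by (intro prob_mono) (auto simp: X23_def G_def)
  also have "\<dots> \<le> (\<Sum>e\<in>S23 - G. P23 (U e \<times> V e))"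
    by (rule prob_UN_le) (rule fin)
  finally have 2: "P23 (X23 - R) \<le> (\<Sum>e\<in>S23 - G. P23 (U e \<times> V e))" .
  have "(\<Sum>e\<in>G. P23 (U e \<times> V e)) + (\<Sum>e\<in>S23 - G. P23 (U e \<times> V e)) = (\<Sum>e\<in>S23. P23 (U e \<times> V e))"
    using finite_parts by (intro sum.subset_diff[symmetric, THEN trans[OF add.commute]]) (auto simp: G_def)
  also have "\<dots> = sum weight S23"
    using parts_subset by (intro sum.cong) (auto simp: prob_times prob_U prob_V weight_eq S23_def)
  finally have "P23 (X23 \<inter> R) + P23 (X23 - R) \<le> 1 / 3"
    using 1 2 sum_weight_S23 by linarith
  moreover have "P23 (X23 \<inter> R) + P23 (R - X23) = 1 / 3"
    using prob_Int_Diff[of "pair_pmf p q" R X23] by (simp add: prob_R Int_commute)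
  ultimately show ?thesis
    by linarith
qed

text \<open>A point \<open>(i, j)\<close> of \<open>X23\<close> outside \<open>R\<close> has \<open>i\<close> in the parity class of the modulus \<open>10\<close> or \<open>j\<close> in the
  class modulo \<open>3\<close> of the modulus \<open>15\<close>.  Either way one residue of \<open>k\<close> modulo \<open>5\<close> is
  already covered.  The constant is \<open>19/100 = 1/5 - 1/100\<close>, a residue modulo \<open>5\<close> less its
  overlap with \<open>X5\<close>.\<close>

lemma prob_T1_le_inside_R:
  "P235 T1 \<le> P235 {t \<in> T1. case t of (i, j, k) \<Rightarrow> (i, j) \<in> R}
    + P23 (R - X23) * (1 - prob r X5 - 19 / 100)"
proof -
  define c where "c = 1 - prob r X5 - 19 / 100"
  have c: "0 \<le> c"
    using prob_X5 by (simp add: c_def)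
  have W: "prob r (- X5 - W e) \<le> c" if "prob r (W e) = 1 / 5" "prob r (W e \<inter> X5) \<le> 1 / 100" for e
  proof -
    have "prob r (- X5) = prob r (- X5 \<inter> W e) + prob r (- X5 - W e)"
      by (rule prob_Int_Diff)
    moreover have "prob r (W e) = prob r (W e \<inter> X5) + prob r (- X5 \<inter> W e)"
      using prob_Int_Diff[of r "W e" X5] by (simp add: Diff_eq Int_commute)
    ultimately show ?thesis
      using that unfolding c_def prob_Compl by linarith
  qed
  define A where "A = (X23 - R) \<inter> U e10 \<times> UNIV"
  define B where "B = (X23 - R) - U e10 \<times> UNIV"
  have "T1 \<subseteq> ({t \<in> T1. case t of (i, j, k) \<Rightarrow> (i, j) \<in> R}
      \<union> {(i, j, k). (i, j) \<in> A \<and> k \<in> - X5 - W e10})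
      \<union> {(i, j, k). (i, j) \<in> B \<and> k \<in> - X5 - W e15}"
    using exponents_in_parts unfolding T1_def A_def B_def R_def X25_def X35_def by auto
  then have "P235 T1 \<le> P235 \<dots>"
    by (rule prob_mono)
  also have "\<dots> \<le> P235 {t \<in> T1. case t of (i, j, k) \<Rightarrow> (i, j) \<in> R}
      + P235 {(i, j, k). (i, j) \<in> A \<and> k \<in> - X5 - W e10}
      + P235 {(i, j, k). (i, j) \<in> B \<and> k \<in> - X5 - W e15}"
    by (intro order_trans[OF prob_Un_le] add_mono order_refl)
  also have "\<dots> = P235 {t \<in> T1. case t of (i, j, k) \<Rightarrow> (i, j) \<in> R}
      + P23 A * prob r (- X5 - W e10) + P23 B * prob r (- X5 - W e15)"
    by (simp only: prob_cylinder_12)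
  also have "\<dots> \<le> P235 {t \<in> T1. case t of (i, j, k) \<Rightarrow> (i, j) \<in> R} + P23 A * c + P23 B * c"
    by (intro add_mono order_refl mult_left_mono W prob_coordinates_10_15_45 prob_W10_X5 prob_W15_X5) auto
  also have "\<dots> = P235 {t \<in> T1. case t of (i, j, k) \<Rightarrow> (i, j) \<in> R} + P23 (X23 - R) * c"
    using prob_Int_Diff[of "pair_pmf p q" "X23 - R" "U e10 \<times> UNIV"]
    by (simp add: A_def B_def distrib_right)
  also have "\<dots> \<le> P235 {t \<in> T1. case t of (i, j, k) \<Rightarrow> (i, j) \<in> R} + P23 (R - X23) * c"
    by (intro add_left_mono mult_right_mono prob_X23_outside_R c)
  finally show ?thesis
    by (simp add: c_def)
qed

text \<open>The first of three estimates for the part of \<open>T1\<close> inside \<open>R\<close>: the uncovered part of \<open>R\<close> is a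
  loss, and refilling it from outside \<open>R\<close> costs \<open>19/100\<close> of it.\<close>

lemma prob_T1_uncovered:
  "P235 T1 \<le> (1 - prob r X5) / 3 - 19 / 100 * P23 (R - X23)"
proof -
  have "P235 {t \<in> T1. case t of (i, j, k) \<Rightarrow> (i, j) \<in> R} \<le> P235 {(i, j, k). (i, j) \<in> X23 \<inter> R \<and> k \<in> - X5}"
    by (intro prob_mono) (auto simp: T1_def)
  also have "\<dots> = P23 (X23 \<inter> R) * (1 - prob r X5)"
    by (simp only: prob_cylinder_12 prob_Compl)
  also have "P23 (X23 \<inter> R) = 1 / 3 - P23 (R - X23)"
    using prob_Int_Diff[of "pair_pmf p q" R X23] by (simp add: prob_R Int_commute)
  finally show ?thesis
    using prob_T1_le_inside_R by (simp add: algebra_simps)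
qed

text \<open>What \<open>X35\<close> covers over \<open>R\<close> is lost for \<open>X23\<close>.  The factor \<open>1/2\<close> is the density of the parity
  class in \<open>R\<close>, of which \<open>X35\<close> is independent; the last summand is the largest possible contribution
  from outside \<open>R\<close>.\<close>

lemma prob_T1_overlap_35:
  "P235 T1 \<le> (1 - prob r X5) / 3 - P35 (X35 \<inter> (- V e15) \<times> (- X5)) / 2
    + P23 (R - X23) * (1 - prob r X5 - 19 / 100)"
proof -
  have "P235 {t \<in> T1. case t of (i, j, k) \<Rightarrow> (i, j) \<in> R}
      \<le> P235 {(i, j, k). i \<in> - U e10 \<and> (j, k) \<in> (- V e15) \<times> (- X5) - X35}"
    by (intro prob_mono) (auto simp: T1_def R_def)
  also have "\<dots> = 1 / 2 * P35 ((- V e15) \<times> (- X5) - X35)"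
    by (simp only: prob_cylinder_23 prob_Compl prob_coordinates_10_15_45) simp
  also have "P35 ((- V e15) \<times> (- X5) - X35) = 2 / 3 * (1 - prob r X5) - P35 (X35 \<inter> (- V e15) \<times> (- X5))"
    by (simp add: prob_Diff prob_times prob_Compl prob_coordinates_10_15_45)
  finally show ?thesis
    using prob_T1_le_inside_R by argo
qed

text \<open>The same for \<open>X2\<close> and \<open>X25\<close>, which are independent of the coordinate \<open>j\<close> and thus of the two
  residues modulo \<open>3\<close> in \<open>R\<close>.\<close>

lemma prob_T1_overlap_25:
  "P235 T1 \<le> (1 - prob r X5) / 3 - 2 / 3 * P25 ((X2 \<times> UNIV \<union> X25) \<inter> (- U e10) \<times> (- X5))
    + P23 (R - X23) * (1 - prob r X5 - 19 / 100)"
proof -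
  let ?Z = "X2 \<times> UNIV \<union> X25"
  have "P235 {t \<in> T1. case t of (i, j, k) \<Rightarrow> (i, j) \<in> R}
      \<le> P235 {(i, j, k). (i, k) \<in> (- U e10) \<times> (- X5) - ?Z \<and> j \<in> - V e15}"
    by (intro prob_mono) (auto simp: T1_def R_def)
  also have "\<dots> = P25 ((- U e10) \<times> (- X5) - ?Z) * (2 / 3)"
    by (simp only: prob_cylinder_13 prob_Compl prob_coordinates_10_15_45) simp
  also have "P25 ((- U e10) \<times> (- X5) - ?Z) = 1 / 2 * (1 - prob r X5) - P25 (?Z \<inter> (- U e10) \<times> (- X5))"
    by (simp only: prob_Diff prob_times prob_Compl prob_coordinates_10_15_45) simp
  finally show ?thesis
    using prob_T1_le_inside_R by argo
qed

section \<open>The position of the class modulo 45\<close>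

lemma gain_T1_35_le_slack:
  assumes "P235 T1 \<le> (1 - prob r X5) / 3 - g1" "P35 Y35 \<le> 1 / 8 - g3" "0 \<le> g3"
  shows "g1 + 7 / 8 * g3 \<le> 1 / 480"
proof -
  have "P235 T2 \<le> (1 - prob q X3) * (1 / 4)"
    by (intro order_trans[OF prob_T2] mult_left_mono prob_Y25_le) auto
  then have "g1 + 0 + 7 / 8 * g3 + 1 / 4 * (1 / 8 - prob p X2) \<le> 1 / 480"
    using assms by (intro gains_le_slack) simp_all
  then show ?thesis
    using prob_X2 by argo
qed

text \<open>Otherwise half of the class modulo \<open>45\<close>, of measure \<open>1/90\<close>, lies over \<open>R\<close>.  To avoid it, the
  other classes must leave a part of \<open>R\<close> uncovered that has about this measure, at a cost of
  \<open>19/100\<close> of it, which just exceeds \<open>1/480\<close>.\<close>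

lemma V45_subset_V15: "V e45 \<subseteq> V e15"
proof (rule ccontr)
  assume "\<not> V e45 \<subseteq> V e15"
  then have disj: "V e45 \<inter> V e15 = {}"
    using nested_V[of e15 e45] by (auto simp: e15_def e45_def)
  let ?t = "prob r (W e45 \<inter> X5)" and ?l = "P23 (R - X23)"
  have "P35 (V e45 \<times> (W e45 - X5)) \<le> P35 (X35 \<inter> (- V e15) \<times> (- X5))"
    using disj exponents_in_parts by (intro prob_mono) (auto simp: X35_def)
  moreover have "prob r (W e45 - X5) = 1 / 5 - ?t"
    using prob_Int_Diff[of r "W e45" X5] prob_coordinates_10_15_45 by simp
  ultimately have overlap: "1 / 45 - ?t / 9 \<le> P35 (X35 \<inter> (- V e15) \<times> (- X5))"
    by (simp add: prob_times prob_coordinates_10_15_45 right_diff_distrib)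
  \<comment> \<open>The bound is chosen just above \<open>(1/480) / (19/100)\<close>.\<close>
  have "?l \<le> 11 / 1000"
    using gain_T1_35_le_slack[OF prob_T1_uncovered, of 0] prob_Y35_le by simp
  have l: "?l * (1 - prob r X5 - 19 / 100) \<le> 11 / 1000 * (81 / 100)"
    using \<open>?l \<le> 11 / 1000\<close> prob_X5 by (intro mult_mono) auto
  have "P235 T1 \<le> (1 - prob r X5) / 3 - (1 / 90 - ?t / 18 - 11 / 1000 * (81 / 100))"
    using prob_T1_overlap_35 overlap l by argo
  from gain_T1_35_le_slack[OF this, of "?t / 9"] prob_Y35_W45_X5
  have "1 / 90 - ?t / 18 - 11 / 1000 * (81 / 100) + 7 / 8 * (?t / 9) \<le> 1 / 480"
    by simp
  moreover have "0 \<le> ?t"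
    by simp
  ultimately show False
    by argo
qed

text \<open>Otherwise the class modulo \<open>45\<close> is contained in the class modulo \<open>15\<close> and is wasted.\<close>

lemma W45_disjoint_W15: "W e45 \<inter> W e15 = {}"
proof (rule ccontr)
  assume "W e45 \<inter> W e15 \<noteq> {}"
  then have sub: "W e45 \<subseteq> W e15"
    using nested_W[of e15 e45] by (auto simp: e15_def e45_def)
  have "P35 Y35 \<le> P35 (\<Union>e\<in>S35 - {e45}. V e \<times> W e)"
  proof (rule prob_mono)
    show "Y35 \<subseteq> (\<Union>e\<in>S35 - {e45}. V e \<times> W e)"
      using sub V45_subset_V15 exponents_in_parts unfolding Y35_def X35_def
      by (force simp: e15_def e45_def)
  qed
  also have "\<dots> \<le> (\<Sum>e\<in>S35 - {e45}. P35 (V e \<times> W e))"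
    using finite_parts by (intro prob_UN_le) auto
  also have "\<dots> = sum weight (S35 - {e45})"
    using parts_subset by (intro sum.cong) (auto simp: prob_times prob_V prob_W weight_eq S35_def)
  also have "\<dots> = sum weight S35 - weight e45"
    using exponents_in_parts finite_parts by (simp add: sum_diff1)
  also have "\<dots> \<le> 1 / 8 - 1 / 45"
    using sum_weight_S35[of e45] exponents_in_parts by (simp add: weight_10_15_45 insert_absorb) (simp add: e45_def)
  finally show False
    using gain_35_le_slack[of "1 / 45"] by simp
qed

section \<open>The contradiction\<close>

text \<open>In the parity class of the modulus \<open>10\<close>, outside the residues modulo \<open>5\<close> of the moduli \<open>15\<close>
  and \<open>45\<close>, there is not enough room for both \<open>X25\<close> and \<open>X2\<close>.  A part of them may lie in the other
  parity class; its measure \<open>z\<close> is charged to \<open>T1\<close>.  A part of \<open>X25\<close> may have a residue modulo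
  \<open>5\<close> of the modulus \<open>15\<close> or \<open>45\<close>; it is charged to \<open>T2\<close>.  Both charges are made at the
  common rate \<open>9/100\<close>, slightly less than the density \<open>1/9\<close> of the class modulo \<open>9\<close> of the
  modulus \<open>45\<close> reduced by its overlap with \<open>X3\<close>.\<close>

lemma no_smooth_cover: False
proof -
  define z where "z = P25 ((X2 \<times> UNIV \<union> X25) \<inter> (- U e10) \<times> (- X5))"
  define l where "l = P23 (R - X23)"
  define b5 where "b5 = 1 - prob r X5"
  have b5: "19 / 20 \<le> b5" "b5 \<le> 1" and l0: "0 \<le> l" and z0: "0 \<le> z"
    using prob_X5 by (simp_all add: b5_def l_def z_def)

  \<comment> \<open>Either \<open>R\<close> is nearly filled by \<open>X23\<close> and \<open>z\<close> is an overlap, or the uncovered part \<open>l\<close> of \<open>R\<close>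
      is charged; a convex combination of the two estimates eliminates \<open>l\<close>.\<close>
  have T1: "P235 T1 \<le> b5 / 3 - 9 / 100 * z"
  proof -
    have 1: "P235 T1 \<le> b5 / 3 - 19 / 100 * l"
      using prob_T1_uncovered by (simp add: b5_def l_def)
    have 2: "P235 T1 \<le> b5 / 3 - 2 / 3 * z + l * (b5 - 19 / 100)"
      using prob_T1_overlap_25 by (simp add: b5_def l_def z_def)
    have "l * (b5 - 19 / 100) \<le> l * (81 / 100)"
      using b5 l0 by (intro mult_left_mono) auto
    with 1 2 z0 show ?thesis by argo
  qed

  \<comment> \<open>\<open>A1\<close> and \<open>A2\<close> are hit by the classes modulo \<open>15\<close> and \<open>45\<close>, and \<open>A3\<close> is the part of \<open>Y25\<close>
      that has to compete with \<open>X2\<close> for room.\<close>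
  define A1 where "A1 = Y25 \<inter> UNIV \<times> W e15"
  define A2 where "A2 = Y25 \<inter> UNIV \<times> W e45"
  define A3 where "A3 = Y25 - UNIV \<times> (W e15 \<union> W e45)"
  have A: "P25 Y25 = P25 A1 + P25 A2 + P25 A3"
  proof -
    have "P25 Y25 = P25 (Y25 \<inter> UNIV \<times> W e15) + P25 (Y25 - UNIV \<times> W e15)"
      by (rule prob_Int_Diff)
    also have "P25 (Y25 - UNIV \<times> W e15) = P25 ((Y25 - UNIV \<times> W e15) \<inter> UNIV \<times> W e45)
        + P25 ((Y25 - UNIV \<times> W e15) - UNIV \<times> W e45)"
      by (rule prob_Int_Diff)
    also have "(Y25 - UNIV \<times> W e15) \<inter> UNIV \<times> W e45 = A2"
      using W45_disjoint_W15 by (auto simp: A2_def)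
    also have "(Y25 - UNIV \<times> W e15) - UNIV \<times> W e45 = A3"
      by (auto simp: A3_def)
    finally show ?thesis by (simp add: A1_def)
  qed
  define b3 where "b3 = 1 - prob q X3"
  have b3: "9 / 100 \<le> b3" using prob_X3 by (simp add: b3_def)
  have T2: "P235 T2 \<le> b3 * P25 Y25 - 9 / 100 * (P25 A1 + P25 A2)"
  proof -
    have "prob q (V e15 \<inter> X3) \<le> prob q X3"
      by (rule prob_mono) auto
    then have V15: "prob q (V e15 \<inter> X3) \<le> 1 / 3 - 9 / 100"
      using prob_X3 by simp
    have V: "prob q (- X3 - V e) \<le> b3 - 9 / 100" if "prob q (V e \<inter> X3) \<le> prob q (V e) - 9 / 100" for e
    proof -
      have "prob q (- X3) = prob q (- X3 \<inter> V e) + prob q (- X3 - V e)"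
        by (rule prob_Int_Diff)
      moreover have "prob q (V e) = prob q (V e \<inter> X3) + prob q (- X3 \<inter> V e)"
        using prob_Int_Diff[of q "V e" X3] by (simp add: Diff_eq Int_commute)
      ultimately show ?thesis
        using that unfolding b3_def prob_Compl by linarith
    qed
    have "T2 \<subseteq> ({(i, j, k). (i, k) \<in> A1 \<and> j \<in> - X3 - V e15} \<union> {(i, j, k). (i, k) \<in> A2 \<and> j \<in> - X3 - V e45})
        \<union> {(i, j, k). (i, k) \<in> A3 \<and> j \<in> - X3}"
      using exponents_in_parts unfolding T2_def A1_def A2_def A3_def X35_def by auto
    then have "P235 T2 \<le> P235 \<dots>"
      by (rule prob_mono)
    also have "\<dots> \<le> P235 {(i, j, k). (i, k) \<in> A1 \<and> j \<in> - X3 - V e15}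
        + P235 {(i, j, k). (i, k) \<in> A2 \<and> j \<in> - X3 - V e45} + P235 {(i, j, k). (i, k) \<in> A3 \<and> j \<in> - X3}"
      by (intro order_trans[OF prob_Un_le] add_mono order_refl)
    also have "\<dots> = P25 A1 * prob q (- X3 - V e15) + P25 A2 * prob q (- X3 - V e45) + P25 A3 * prob q (- X3)"
      by (simp only: prob_cylinder_13)
    also have "\<dots> \<le> P25 A1 * (b3 - 9 / 100) + P25 A2 * (b3 - 9 / 100) + P25 A3 * b3"
      using V15 prob_V45_X3
      by (intro add_mono mult_left_mono V) (auto simp: prob_coordinates_10_15_45 b3_def prob_Compl)
    also have "\<dots> = b3 * P25 Y25 - 9 / 100 * (P25 A1 + P25 A2)"
      by (simp add: A algebra_simps)
    finally show ?thesis .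
  qed
  \<comment> \<open>In the parity class of the modulus \<open>10\<close>, the set \<open>A3\<close> has three residues modulo \<open>5\<close> at its
      disposal, less the part of \<open>X2\<close> in this parity class.  The part of \<open>X2\<close> in the other parity
      class is counted by \<open>z\<close>.\<close>
  have A3: "P25 A3 \<le> z + 3 / 5 * (1 / 2 - prob p X2)"
  proof -
    have 1: "P25 A3 = P25 (A3 \<inter> (- U e10) \<times> UNIV) + P25 (A3 - (- U e10) \<times> UNIV)"
      by (rule prob_Int_Diff)
    have "P25 (A3 - (- U e10) \<times> UNIV) \<le> P25 ((U e10 - X2) \<times> (- (W e15 \<union> W e45)))"
      by (intro prob_mono) (auto simp: A3_def Y25_def)
    also have "\<dots> = prob p (U e10 - X2) * (3 / 5)"
    proof -
      have "prob r (W e15 \<union> W e45) = prob r (W e15) + prob r (W e45)"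
        using W45_disjoint_W15 by (intro measure_pmf.finite_measure_Union) auto
      then show ?thesis by (simp only: prob_times prob_Compl prob_coordinates_10_15_45) simp
    qed
    also have "prob p (U e10 - X2) = 1 / 2 - prob p (U e10 \<inter> X2)"
      using prob_Int_Diff[of p "U e10" X2] prob_coordinates_10_15_45 by simp
    also have "prob p (U e10 \<inter> X2) = prob p X2 - prob p (X2 - U e10)"
      using prob_Int_Diff[of p X2 "U e10"] by (simp add: Int_commute)
    finally have 2: "P25 (A3 - (- U e10) \<times> UNIV) \<le> (1 / 2 - (prob p X2 - prob p (X2 - U e10))) * (3 / 5)" .
    have "P25 ((X2 - U e10) \<times> (- X5)) + P25 (A3 \<inter> (- U e10) \<times> UNIV)
        = P25 ((X2 - U e10) \<times> (- X5) \<union> (A3 \<inter> (- U e10) \<times> UNIV))"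
      by (intro measure_pmf.finite_measure_Union[symmetric]) (auto simp: A3_def Y25_def)
    also have "\<dots> \<le> z"
      unfolding z_def by (intro prob_mono) (auto simp: A3_def Y25_def)
    finally have 3: "prob p (X2 - U e10) * b5 + P25 (A3 \<inter> (- U e10) \<times> UNIV) \<le> z"
      by (simp add: prob_times prob_Compl b5_def)
    have "prob p (X2 - U e10) * (3 / 5) \<le> prob p (X2 - U e10) * b5"
      using b5 by (intro mult_left_mono) auto
    with 1 2 3 show ?thesis by argo
  qed
  \<comment> \<open>The weight of \<open>Y25\<close> is split: a share \<open>9/100\<close> is bounded through \<open>A3\<close>, and the rest by the
      trivial bound \<open>1/4\<close>.\<close>
  have "P235 T2 \<le> b3 / 4 - (9 / 400 - 9 / 100 * z - 27 / 500 * (1 / 2 - prob p X2))"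
  proof -
    have "(b3 - 9 / 100) * P25 Y25 \<le> (b3 - 9 / 100) * (1 / 4)"
      using b3 prob_Y25_le by (intro mult_left_mono) auto
    moreover have "(b3 - 9 / 100) * P25 Y25 = b3 * P25 Y25 - 9 / 100 * P25 Y25"
      by (simp add: left_diff_distrib)
    ultimately show ?thesis
      using T2 A A3 by argo
  qed
  with T1 have "9 / 100 * z + (9 / 400 - 9 / 100 * z - 27 / 500 * (1 / 2 - prob p X2))
      + 7 / 8 * 0 + 1 / 4 * (1 / 8 - prob p X2) \<le> 1 / 480"
    using prob_Y35_le by (intro gains_le_slack) (simp_all add: b3_def b5_def)
  then show False
    using prob_X2 by argo
qed

end

section \<open>From covering systems to coordinates\<close>

lemma common_residue:
  "\<exists>x :: int. [x = i] (mod 2 ^ M) \<and> [x = j] (mod 3 ^ M) \<and> [x = k] (mod 5 ^ M)"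
proof -
  have "coprime (2 ^ M :: int) (3 ^ M)"
    by simp
  then obtain y :: int where y: "[y = i] (mod 2 ^ M)" "[y = j] (mod 3 ^ M)"
    using binary_chinese_remainder_int by blast
  have "coprime (3 :: int) 5"
    by (simp add: coprime_iff_gcd_eq_1 gcd_non_0_int)
  then have "coprime (2 ^ M * 3 ^ M :: int) (5 ^ M)"
    by simp
  then obtain x :: int where x: "[x = y] (mod 2 ^ M * 3 ^ M)" "[x = k] (mod 5 ^ M)"
    using binary_chinese_remainder_int by blast
  have "[x = y] (mod 2 ^ M)" "[x = y] (mod 3 ^ M)"
    using x(1) by (auto intro: cong_modulus_mult simp: mult.commute)
  with x y show ?thesis
    by (blast intro: cong_trans)
qed

lemma exponent_le:
  assumes "(2::nat) ^ a * 3 ^ b * 5 ^ c \<le> M"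
  shows "a \<le> M" "b \<le> M" "c \<le> M"
proof -
  have "a < (2::nat) ^ a" "b < (3::nat) ^ b" "c < (5::nat) ^ c"
    by (simp_all add: less_exp power_gt_expt)
  moreover have "(2::nat) ^ a \<le> 2 ^ a * 3 ^ b * 5 ^ c" "(3::nat) ^ b \<le> 2 ^ a * 3 ^ b * 5 ^ c"
      "(5::nat) ^ c \<le> 2 ^ a * 3 ^ b * 5 ^ c"
    by (simp_all add: dvd_imp_le)
  ultimately show "a \<le> M" "b \<le> M" "c \<le> M"
    using assms by linarith+
qed

theorem theorem1p12:
  fixes C :: "(int \<times> nat) set" and m :: nat
  assumes "distinct_covering_system C"
    and "\<forall>n\<in>moduli C. \<exists>a b c :: nat. n = 2 ^ a * 3 ^ b * 5 ^ c"
    and "m = least_modulus C"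
  shows "m \<le> 9"
proof (rule ccontr)
  assume "\<not> m \<le> 9"
  have cov: "finite C" "\<And>x::int. \<exists>(s, n)\<in>C. [x = s] (mod int n)" and inj: "inj_on snd C"
    using assms(1) by (auto simp: distinct_covering_system_def covering_system_def)
  have fin: "finite (moduli C)"
    using cov(1) by (simp add: moduli_def)
  have ge: "10 \<le> n" if "n \<in> moduli C" for n
    using Min_le[OF fin that] assms(3) \<open>\<not> m \<le> 9\<close> by (simp add: least_modulus_def)
  \<comment> \<open>Every exponent is below the largest modulus, so it can serve as a common bound for all of them.\<close>
  define M where "M = Max (moduli C)"
  define modulus :: "nat \<times> nat \<times> nat \<Rightarrow> nat" where "modulus = (\<lambda>(a, b, c). 2 ^ a * 3 ^ b * 5 ^ c)"
  define S where "S = {e. modulus e \<in> moduli C}"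
  define \<rho> where "\<rho> e = (SOME s. (s, modulus e) \<in> C)" for e
  have bound: "a \<le> M" "b \<le> M" "c \<le> M" if "(a, b, c) \<in> S" for a b c
    using exponent_le[of a b c M] Max_ge[OF fin, of "modulus (a, b, c)"] that
    by (simp_all add: S_def M_def modulus_def)
  have \<rho>: "\<rho> e = s" if "(s, modulus e) \<in> C" for s e
  proof -
    have "(\<rho> e, modulus e) \<in> C"
      unfolding \<rho>_def by (rule someI) (rule that)
    from inj_onD[OF inj _ this that] show ?thesis
      by simp
  qed
  have prob_class: "prob (pmf_of_set {0..<x ^ M}) (residue_class (x ^ a) s) = 1 / real_of_int x ^ a"
    if "a \<le> M" "x > 0" for a x s
    using that by (subst prob_residue_class) (simp_all add: le_imp_power_dvd)
  interpret smooth_cover "pmf_of_set {0..<2 ^ M}" "pmf_of_set {0..<3 ^ M}" "pmf_of_set {0..<5 ^ M}" S \<rho>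
  proof
    show "finite S"
      by (rule finite_subset[of _ "{..M} \<times> {..M} \<times> {..M}"]) (use bound in auto)
  next
    fix a b c :: nat
    assume "(a, b, c) \<in> S"
    then show "10 \<le> 2 ^ a * 3 ^ b * (5 ^ c :: nat)"
      using ge by (auto simp: S_def modulus_def)
  next
    fix a b c :: nat and s
    assume "(a, b, c) \<in> S"
    note le = bound[OF this]
    show "prob (pmf_of_set {0..<2 ^ M}) (residue_class (2 ^ a) s) = 1 / 2 ^ a"
      using prob_class[OF le(1), of 2] by simp
    show "prob (pmf_of_set {0..<3 ^ M}) (residue_class (3 ^ b) s) = 1 / 3 ^ b"
      using prob_class[OF le(2), of 3] by simp
    show "prob (pmf_of_set {0..<5 ^ M}) (residue_class (5 ^ c) s) = 1 / 5 ^ c"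
      using prob_class[OF le(3), of 5] by simp
  next
    fix i j k :: int
    obtain x :: int where x: "[x = i] (mod 2 ^ M)" "[x = j] (mod 3 ^ M)" "[x = k] (mod 5 ^ M)"
      using common_residue by blast
    obtain s n where sn: "(s, n) \<in> C" "[x = s] (mod int n)"
      using cov(2)[of x] by auto
    then have "n \<in> moduli C"
      by (force simp: moduli_def)
    with assms(2) obtain a b c where n: "n = modulus (a, b, c)"
      by (auto simp: modulus_def)
    have e: "(a, b, c) \<in> S"
      using \<open>n \<in> moduli C\<close> n by (simp add: S_def)
    have s: "\<rho> (a, b, c) = s"
      using \<rho> sn(1) n by simp
    have "int n = 2 ^ a * 3 ^ b * 5 ^ c"
      by (simp add: n modulus_def)
    then have dvd: "2 ^ a dvd int n" "3 ^ b dvd int n" "5 ^ c dvd int n"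
      by simp_all
    have "[i = s] (mod 2 ^ a)" "[j = s] (mod 3 ^ b)" "[k = s] (mod 5 ^ c)"
      using cong_dvd_modulus[OF x(1) le_imp_power_dvd[OF bound(1)[OF e]]]
        cong_dvd_modulus[OF x(2) le_imp_power_dvd[OF bound(2)[OF e]]]
        cong_dvd_modulus[OF x(3) le_imp_power_dvd[OF bound(3)[OF e]]]
        cong_dvd_modulus[OF sn(2) dvd(1)] cong_dvd_modulus[OF sn(2) dvd(2)] cong_dvd_modulus[OF sn(2) dvd(3)]
      by (blast intro: cong_trans cong_sym)+
    then show "\<exists>(a, b, c)\<in>S. i \<in> residue_class (2 ^ a) (\<rho> (a, b, c))
        \<and> j \<in> residue_class (3 ^ b) (\<rho> (a, b, c)) \<and> k \<in> residue_class (5 ^ c) (\<rho> (a, b, c))"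
      using e s by (intro bexI[of _ "(a, b, c)"]) (simp_all add: residue_class_def)
  qed
  show False
    by (rule no_smooth_cover)
qed

end
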